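(* Let $\gamma>0$ and fix $U'=(\bm{u}'_1,\dots,\bm{u}'_m)\in\mathbb{R}^{d\times m}$ and $V'=(\bm{v}'_1,\dots,\bm{v}'_m)\in\mathbb{R}^{d\times m}$ arbitrarily. Then, for each $i=1,\dots,m$, the solutions (unique minimizers) $\bm{u}_i^*$ and $\bm{v}_i^*$ of the two optimization problems $$\min_{\bm{u}_i\in\mathbb{R}^d}F(\bm{u}'_1,\dots,\bm{u}'_{i-1},\bm{u}_i,\bm{u}'_{i+1},\dots,\bm{u}'_m,V';\gamma),$$ $$\min_{\bm{v}_i\in\mathbb{R}^d}F(U',\bm{v}'_1,\dots,\bm{v}'_{i-1},\bm{v}_i,\bm{v}'_{i+1},\dots,\bm{v}'_m;\gamma)$$ are respectively $\bm{u}_i^* = A_{\bm{u}_i}^{-1}\bm{b}_{\bm{u}_i}$ and $\bm{v}_i^* = A_{\bm{v}_i}^{-1}\bm{b}_{\bm{v}_i}$, where $$A_{\bm{u}_i} := \gamma I_d + \sum_{j\in E_{\mathrm{ss}}[i]}(\bm{v}'_i-\bm{v}'_j)(\bm{v}'_i-\bm{v}'_j)^\top + \sum_{k\in E_{\mathrm{sa}}[i]}(\bm{v}'_i-\bm{a}_k)(\bm{v}'_i-\bm{a}_k)^\top,$$ $$\bm{b}_{\bm{u}_i} := \gamma\bm{v}'_i + \sum_{j\in E_{\mathrm{ss}}[i]}\bigl((\bm{u}'_j)^\top\bm{v}'_i - (\bm{u}'_j)^\top\bm{v}'_j+d_{ij}^2\bigr)(\bm{v}'_i-\bm{v}'_j)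 + \sum_{k\in E_{\mathrm{sa}}[i]}\bigl(\bm{a}_k^\top\bm{v}'_i-\bm{a}_k^\top\bm{a}_k+d_{ik}^2\bigr)(\bm{v}'_i-\bm{a}_k),$$ $$A_{\bm{v}_i} := \gamma I_d + \sum_{j\in E_{\mathrm{ss}}[i]}(\bm{u}'_i-\bm{u}'_j)(\bm{u}'_i-\bm{u}'_j)^\top + \sum_{k\in E_{\mathrm{sa}}[i]}(\bm{u}'_i-\bm{a}_k)(\bm{u}'_i-\bm{a}_k)^\top,$$ $$\bm{b}_{\bm{v}_i} := \gamma\bm{u}'_i + \sum_{j\in E_{\mathrm{ss}}[i]}\bigl((\bm{v}'_j)^\top\bm{u}'_i - (\bm{v}'_j)^\top\bm{u}'_j+d_{ij}^2\bigr)(\bm{u}'_i-\bm{u}'_j) + \sum_{k\in E_{\mathrm{sa}}[i]}\bigl(\bm{a}_k^\top\bm{u}'_i-\bm{a}_k^\top\bm{a}_k+d_{ik}^2\bigr)(\bm{u}'_i-\bm{a}_k).$$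
   Context: Setting (sensor network localization). Let $d,m,n$ be positive integers. Sensors are indexed by $1,\dots,m$ and anchors by $m+1,\dots,m+n$; anchor $k$ has known position $\bm{a}_k\in\mathbb{R}^d$. $E_{\mathrm{ss}}$ is a set of unordered pairs $ij=\{i,j\}$ of distinct sensors, and $E_{\mathrm{sa}}$ is a set of pairs $ik=\{i,k\}$ consisting of a sensor $i$ and an anchor $k$. For each $ij\in E_{\mathrm{ss}}$ and $ik\in E_{\mathrm{sa}}$, nonnegative real numbers $d_{ij}$ (symmetric in $i,j$) and $d_{ik}$ (measured distances) are given. For $i=1,\dots,m$, $E_{\mathrm{ss}}[i]=\{j: ij\in E_{\mathrm{ss}}\}$ and $E_{\mathrm{sa}}[i]=\{k: ik\in E_{\mathrm{sa}}\}$. For $U=(\bm{u}_1,\dots,\bm{u}_m)$ and $V=(\bm{v}_1,\dots,\bm{v}_m)$ in $\mathbb{R}^{d\times m}$ (columns $\bm{u}_i,\bm{v}_i\in\mathbb{R}^d$) define $$f(U,V) := \frac{1}{2}\sum_{ij\in E_{\mathrm{ss}}}\left((\bm{u}_i-\bm{u}_j)^\top(\bm{v}_i-\bm{v}_j)-d_{ij}^2\right)^2 + \frac{1}{2}\sum_{ik\in E_{\mathrm{sa}}}\left((\bm{a}_k-\bm{u}_i)^\top(\bm{a}_k-\bm{v}_i)-d_{ik}^2\right)^2,$$ $$F(U,V;\gamma) := \frac{\gamma}{2}\|U-V\|_F^2+f(U,V),$$ where $\|\cdot\|_F$ is the Frobenius norm. (Equivalently, the inner terms of $f$ are $A_{ij}\bullet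 PQ^\top-d_{ij}^2$ and $A_{ik}\bullet PQ^\top-d_{ik}^2$, where $P=\begin{pmatrix}I_d \\ U^\top\end{pmatrix}$, $Q=\begin{pmatrix}I_d \\ V^\top\end{pmatrix}$, $A\bullet B=\mathrm{tr}(A^\top B)$, $A_{ij}=ww^\top$ with $w=\begin{pmatrix}\bm{0}_d\\ \bm{e}_i-\bm{e}_j\end{pmatrix}$, $A_{ik}=ww^\top$ with $w=\begin{pmatrix}\bm{a}_k\\-\bm{e}_i\end{pmatrix}$, and $\bm{e}_1,\dots,\bm{e}_m$ is the canonical basis of $\mathbb{R}^m$.) $F$ is written with the columns of $U$ and/or $V$ listed as separate arguments when convenient. *)

theory Defs
  imports "HOL-Analysis.Analysis" "HOL-Library.Uprod"
begin

text \<open>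
  Sensors are the elements of the finite type \<open>'m\<close>, anchors those of the finite type \<open>'n\<close>, and the
  ambient space is \<open>real ^ 'd\<close>. A \<open>d \<times> m\<close> matrix is \<open>U :: real ^ 'm ^ 'd\<close>, and \<open>column i U\<close> is
  the vector attached to sensor \<open>i\<close>. A sensor-sensor edge is an unordered pair in \<open>'m uprod\<close>, so that
  a distance \<open>dss :: 'm uprod \<Rightarrow> real\<close> is symmetric by its type. A sensor-anchor edge is a pair
  \<open>(i, k)\<close> in \<open>'m \<times> 'n\<close>.
\<close>

lift_definition ss_product :: "real ^ 'm ^ 'd \<Rightarrow> real ^ 'm ^ 'd \<Rightarrow> 'm uprod \<Rightarrow> real"
  is "\<lambda>U V (i, j). (column i U - column j U) \<bullet> (column i V - column j V)"
  by (auto simp: inner_diff_left inner_diff_right)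

lemma ss_product_Upair [simp]:
  "ss_product U V (Upair i j) = (column i U - column j U) \<bullet> (column i V - column j V)"
  by transfer simp

definition f_snl ::
  "'m::finite uprod set \<Rightarrow> ('m \<times> 'n::finite) set \<Rightarrow> ('n \<Rightarrow> real ^ 'd::finite) \<Rightarrow>
   ('m uprod \<Rightarrow> real) \<Rightarrow> ('m \<times> 'n \<Rightarrow> real) \<Rightarrow> real ^ 'm ^ 'd \<Rightarrow> real ^ 'm ^ 'd \<Rightarrow> real" where
  "f_snl Ess Esa a dss dsa U V =
     1/2 * (\<Sum>e\<in>Ess. (ss_product U V e - (dss e)\<^sup>2)\<^sup>2) +
     1/2 * (\<Sum>(i, k)\<in>Esa. ((a k - column i U) \<bullet> (a k - column i V) - (dsa (i, k))\<^sup>2)\<^sup>2)"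

text \<open>The library norm on \<open>real ^ 'm ^ 'd\<close> is the Frobenius norm:\<close>

lemma norm_matrix_eq_Frobenius:
  fixes A :: "real ^ 'm::finite ^ 'd::finite"
  shows "norm A = sqrt (\<Sum>r\<in>UNIV. \<Sum>c\<in>UNIV. (A $ r $ c)\<^sup>2)"
  by (simp add: norm_vec_def L2_set_def sum_nonneg)

definition F_snl ::
  "'m::finite uprod set \<Rightarrow> ('m \<times> 'n::finite) set \<Rightarrow> ('n \<Rightarrow> real ^ 'd::finite) \<Rightarrow>
   ('m uprod \<Rightarrow> real) \<Rightarrow> ('m \<times> 'n \<Rightarrow> real) \<Rightarrow> real \<Rightarrow> real ^ 'm ^ 'd \<Rightarrow> real ^ 'm ^ 'd \<Rightarrow> real" where
  "F_snl Ess Esa a dss dsa \<gamma> U V = \<gamma> / 2 * (norm (U - V))\<^sup>2 + f_snl Ess Esa a dss dsa U V"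

definition upd_column :: "'m \<Rightarrow> real ^ 'd \<Rightarrow> real ^ 'm ^ 'd \<Rightarrow> real ^ 'm ^ 'd" where
  "upd_column i x U = (\<chi> r c. if c = i then x $ r else U $ r $ c)"

definition ss_nbrs :: "'m uprod set \<Rightarrow> 'm \<Rightarrow> 'm set" where
  "ss_nbrs Ess i = {j. Upair i j \<in> Ess}"

definition sa_nbrs :: "('m \<times> 'n) set \<Rightarrow> 'm \<Rightarrow> 'n set" where
  "sa_nbrs Esa i = {k. (i, k) \<in> Esa}"

definition outer_square :: "real ^ 'd \<Rightarrow> real ^ 'd ^ 'd" where
  "outer_square w = (columnvector w :: real ^ 1 ^ 'd) ** (rowvector w :: real ^ 'd ^ 1)"

text \<open>
  The linear systems of the two block updates differ only in the roles of \<open>U\<close> and \<open>V\<close>. When column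
  \<open>i\<close> of \<open>U\<close> is updated with \<open>V\<close> fixed, the system has matrix \<open>A_snl \<dots> V i\<close> and right-hand side
  \<open>b_snl \<dots> U V i\<close>; when column \<open>i\<close> of \<open>V\<close> is updated with \<open>U\<close> fixed, it has matrix \<open>A_snl \<dots> U i\<close> and
  right-hand side \<open>b_snl \<dots> V U i\<close>. So below \<open>X\<close> is the updated matrix and \<open>Y\<close> the fixed one.
\<close>

definition A_snl ::
  "'m::finite uprod set \<Rightarrow> ('m \<times> 'n::finite) set \<Rightarrow> ('n \<Rightarrow> real ^ 'd::finite) \<Rightarrow>
   real \<Rightarrow> real ^ 'm ^ 'd \<Rightarrow> 'm \<Rightarrow> real ^ 'd ^ 'd" where
  "A_snl Ess Esa a \<gamma> Y i =
     \<gamma> *\<^sub>R mat 1 +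
     (\<Sum>j\<in>ss_nbrs Ess i. outer_square (column i Y - column j Y)) +
     (\<Sum>k\<in>sa_nbrs Esa i. outer_square (column i Y - a k))"

definition b_snl ::
  "'m::finite uprod set \<Rightarrow> ('m \<times> 'n::finite) set \<Rightarrow> ('n \<Rightarrow> real ^ 'd::finite) \<Rightarrow>
   ('m uprod \<Rightarrow> real) \<Rightarrow> ('m \<times> 'n \<Rightarrow> real) \<Rightarrow>
   real \<Rightarrow> real ^ 'm ^ 'd \<Rightarrow> real ^ 'm ^ 'd \<Rightarrow> 'm \<Rightarrow> real ^ 'd" where
  "b_snl Ess Esa a dss dsa \<gamma> X Y i =
     \<gamma> *\<^sub>R column i Y +
     (\<Sum>j\<in>ss_nbrs Ess i.
        (column j X \<bullet> column i Y - column j X \<bullet> column j Y + (dss (Upair i j))\<^sup>2) *\<^sub>R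
        (column i Y - column j Y)) +
     (\<Sum>k\<in>sa_nbrs Esa i.
        (a k \<bullet> column i Y - a k \<bullet> a k + (dsa (i, k))\<^sup>2) *\<^sub>R (column i Y - a k))"

end

theory Submission
  imports Defs
begin

text \<open>
  With \<open>V'\<close> and all the other columns of \<open>U'\<close> held fixed, every residual in \<open>F\<close> is affine in the free
  column \<open>x\<close>: a term in which sensor \<open>i\<close> takes part has the form \<open>x \<bullet> w - c\<close>, where
  \<open>w\<close> is the difference between \<open>v'\<^sub>i\<close> and the vector at the other end of the edge, and every other
  term is constant. Hence \<open>F\<close> is, up to a constant, the regularised least squares function
  \<open>\<gamma>/2 \<parallel>x - v'\<^sub>i\<parallel>\<^sup>2 + 1/2 \<Sum> (x \<bullet> w - c)\<^sup>2\<close>. Expanding the squares turns it into the quadratic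
  \<open>1/2 x \<bullet> A x - b \<bullet> x + C\<close> whose matrix and vector are the \<open>A\<close> and \<open>b\<close> of the theorem
  (\<open>F_snl_upd_column_quadratic\<close>).

  The matrix \<open>A\<close> is \<open>\<gamma> I\<close> plus a sum of squares \<open>w w\<^sup>T\<close>, so it is symmetric and positive
  definite. Completing the square, the quadratic exceeds its value at \<open>A\<^sup>-\<^sup>1 b\<close> by half the
  energy of the displacement, so that this point is the unique minimizer
  (\<open>is_arg_min_quadratic_iff\<close>).

  The problem for a column of \<open>V'\<close> needs no separate argument, since \<open>F\<close> is symmetric in its two matrix
  arguments.
\<close>

section \<open>Minimizers of positive definite quadratics\<close>

lemma invertible_pos_def:
  fixes A :: "real ^ 'd::finite ^ 'd"
  assumes pos: "\<And>x. x \<noteq> 0 \<Longrightarrow> 0 < x \<bullet> (A *v x)"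
  shows "invertible A"
proof -
  have "x = 0" if "A *v x = 0" for x
    using pos[of x] that by fastforce
  then show ?thesis
    by (simp add: invertible_left_inverse matrix_left_invertible_ker)
qed

lemma matrix_mult_matrix_inv:
  assumes "invertible A"
  shows "A ** matrix_inv A = mat 1"
  using someI_ex[OF assms[unfolded invertible_def]] by (simp add: matrix_inv_def)

text \<open>
  Completing the square at the solution \<open>s\<close> of \<open>A s = b\<close> gives
  \<open>q x = q s + 1/2 (x - s) \<bullet> A (x - s)\<close>. The linear part in \<open>x - s\<close> cancels because \<open>A\<close> is
  symmetric, and the quadratic part is positive away from \<open>s\<close>.
\<close>

lemma is_arg_min_quadratic_iff:
  fixes A :: "real ^ 'd::finite ^ 'd" and q :: "real ^ 'd \<Rightarrow> real"
  assumes sym: "\<And>x y. x \<bullet> (A *v y) = y \<bullet> (A *v x)"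
    and pos: "\<And>x. x \<noteq> 0 \<Longrightarrow> 0 < x \<bullet> (A *v x)"
    and q: "\<And>x. q x = 1/2 * (x \<bullet> (A *v x)) - b \<bullet> x + C"
  shows "is_arg_min q (\<lambda>_. True) u \<longleftrightarrow> u = matrix_inv A *v b"
proof -
  define s where "s = matrix_inv A *v b"
  have "invertible A"
    using pos by (rule invertible_pos_def)
  then have As: "A *v s = b"
    by (simp add: s_def matrix_vector_mul_assoc matrix_mult_matrix_inv)
  have square: "q x = q s + 1/2 * ((x - s) \<bullet> (A *v (x - s)))" for x
  proof -
    have "s \<bullet> (A *v x) = b \<bullet> x"
      using sym[of s x] by (simp add: As inner_commute)
    then show ?thesis
      by (simp add: q As matrix_vector_mult_diff_distrib inner_diff_left inner_diff_right
          inner_commute field_simps)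
  qed
  have less: "q s < q x" if "x \<noteq> s" for x
    using square[of x] pos[of "x - s"] that by simp
  show ?thesis
    unfolding is_arg_min_def s_def[symmetric] using less by (metis less_asym)
qed

section \<open>The matrix of the linear system\<close>

lemma outer_square_mult: "outer_square w *v x = (w \<bullet> x) *\<^sub>R w"
  by (simp add: outer_square_def vec_eq_iff matrix_vector_mult_def matrix_matrix_mult_def
      columnvector_def rowvector_def inner_vec_def sum_distrib_left sum_distrib_right mult_ac)

lemma sum_matrix_vector_mult:
  fixes f :: "'b \<Rightarrow> real ^ 'd::finite ^ 'c::finite"
  shows "(\<Sum>j\<in>S. f j) *v x = (\<Sum>j\<in>S. f j *v x)"
  by (induction S rule: infinite_finite_induct) (auto simp: matrix_vector_mult_add_rdistrib)

text \<open>
  The bilinear form of \<open>A\<close>; from this expression the symmetry and the positivity of the form, as well as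
  the expansion of the objective, can be read off.
\<close>

lemma inner_A_snl_mult:
  "y \<bullet> (A_snl Ess Esa a \<gamma> Y i *v x) =
     \<gamma> * (y \<bullet> x) +
     (\<Sum>j\<in>ss_nbrs Ess i. (x \<bullet> (column i Y - column j Y)) * (y \<bullet> (column i Y - column j Y))) +
     (\<Sum>k\<in>sa_nbrs Esa i. (x \<bullet> (column i Y - a k)) * (y \<bullet> (column i Y - a k)))"
  by (simp add: A_snl_def matrix_vector_mult_add_rdistrib sum_matrix_vector_mult
      outer_square_mult scaleR_matrix_vector_assoc[symmetric] inner_add_right inner_sum_right
      inner_commute[of "column i Y - _" x])

lemma A_snl_sym:
  "x \<bullet> (A_snl Ess Esa a \<gamma> Y i *v y) = y \<bullet> (A_snl Ess Esa a \<gamma> Y i *v x)"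
  by (simp add: inner_A_snl_mult inner_commute[of x y] mult.commute)

lemma A_snl_pos_def:
  assumes "0 < \<gamma>" and "x \<noteq> 0"
  shows "0 < x \<bullet> (A_snl Ess Esa a \<gamma> Y i *v x)"
  unfolding inner_A_snl_mult using assms
  by (intro add_pos_nonneg sum_nonneg) auto

section \<open>The objective as a function of one column\<close>

lemma F_snl_commute: "F_snl Ess Esa a dss dsa \<gamma> U V = F_snl Ess Esa a dss dsa \<gamma> V U"
proof -
  have "ss_product U V e = ss_product V U e" for e
    by (cases e) (simp add: inner_commute)
  then show ?thesis
    by (simp add: F_snl_def f_snl_def norm_minus_commute inner_commute)
qed

lemma column_upd_column: "column j (upd_column i x U) = (if j = i then x else column j U)"
  by (simp add: column_def upd_column_def vec_eq_iff)

lemma power2_norm_eq_sum_columns: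
  fixes M :: "real ^ 'm::finite ^ 'd::finite"
  shows "(norm M)\<^sup>2 = (\<Sum>c\<in>UNIV. (norm (column c M))\<^sup>2)"
proof -
  have "(norm M)\<^sup>2 = (\<Sum>r\<in>UNIV. \<Sum>c\<in>UNIV. (M $ r $ c)\<^sup>2)"
    by (simp add: norm_matrix_eq_Frobenius sum_nonneg)
  also have "\<dots> = (\<Sum>c\<in>UNIV. \<Sum>r\<in>UNIV. (M $ r $ c)\<^sup>2)"
    by (rule sum.swap)
  also have "\<dots> = (\<Sum>c\<in>UNIV. (norm (column c M))\<^sup>2)"
    by (simp add: norm_vec_def L2_set_def sum_nonneg column_def)
  finally show ?thesis .
qed

lemma column_diff: "column c (U - V) = column c U - column c V"
  by (simp add: column_def vec_eq_iff)

lemma Frobenius_upd_column: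
  fixes U V :: "real ^ 'm::finite ^ 'd::finite"
  shows "(norm (upd_column i x U - V))\<^sup>2 =
    (norm (x - column i V))\<^sup>2 + (\<Sum>c\<in>UNIV - {i}. (norm (column c U - column c V))\<^sup>2)"
  unfolding power2_norm_eq_sum_columns
  by (subst sum.remove[of UNIV i]) (auto simp: column_diff column_upd_column intro!: sum.cong)

lemma finite_uprod_set:
  fixes E :: "'m::finite uprod set"
  shows "finite E"
  by (rule finite_subset[OF subset_UNIV]) simp

text \<open>
  The edges at sensor \<open>i\<close> correspond to its neighbours. Since an edge is proper, the neighbour is
  different from \<open>i\<close> and keeps its column, so that the residual is affine in \<open>x\<close>.
\<close>

lemma ss_sum_upd_column:
  fixes Ess :: "'m::finite uprod set"
  assumes proper: "\<forall>e\<in>Ess. proper_uprod e"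
  shows "(\<Sum>e\<in>Ess. (ss_product (upd_column i x U) V e - (dss e)\<^sup>2)\<^sup>2) =
    (\<Sum>j\<in>ss_nbrs Ess i. (x \<bullet> (column i V - column j V) -
        (column j U \<bullet> column i V - column j U \<bullet> column j V + (dss (Upair i j))\<^sup>2))\<^sup>2) +
    (\<Sum>e\<in>{e\<in>Ess. i \<notin> set_uprod e}. (ss_product U V e - (dss e)\<^sup>2)\<^sup>2)"
proof -
  let ?r = "\<lambda>e. (ss_product (upd_column i x U) V e - (dss e)\<^sup>2)\<^sup>2"
  have edges_at: "{e\<in>Ess. i \<in> set_uprod e} = Upair i ` ss_nbrs Ess i"
  proof (intro equalityI subsetI)
    fix e assume e: "e \<in> {e\<in>Ess. i \<in> set_uprod e}"
    obtain k l where kl: "e = Upair k l" by (cases e)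
    with e have "e = Upair i l \<or> e = Upair i k" by auto
    with e show "e \<in> Upair i ` ss_nbrs Ess i" by (auto simp: ss_nbrs_def)
  qed (auto simp: ss_nbrs_def)
  have inj: "inj_on (Upair i) (ss_nbrs Ess i)"
    by (auto simp: inj_on_def)
  have "(\<Sum>e\<in>Ess. ?r e) =
      (\<Sum>e\<in>{e\<in>Ess. i \<in> set_uprod e}. ?r e) + (\<Sum>e\<in>{e\<in>Ess. i \<notin> set_uprod e}. ?r e)"
    by (subst sum.union_disjoint[symmetric]) (auto intro!: sum.cong finite_uprod_set)
  also have "(\<Sum>e\<in>{e\<in>Ess. i \<in> set_uprod e}. ?r e) = (\<Sum>j\<in>ss_nbrs Ess i. ?r (Upair i j))"
    by (simp add: edges_at sum.reindex[OF inj])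
  also have "\<dots> = (\<Sum>j\<in>ss_nbrs Ess i. (x \<bullet> (column i V - column j V) -
        (column j U \<bullet> column i V - column j U \<bullet> column j V + (dss (Upair i j))\<^sup>2))\<^sup>2)"
  proof (rule sum.cong[OF refl])
    fix j assume "j \<in> ss_nbrs Ess i"
    then have "j \<noteq> i" using proper by (auto simp: ss_nbrs_def)
    then show "?r (Upair i j) = (x \<bullet> (column i V - column j V) -
        (column j U \<bullet> column i V - column j U \<bullet> column j V + (dss (Upair i j))\<^sup>2))\<^sup>2"
      by (simp add: column_upd_column inner_diff_left inner_diff_right algebra_simps)
  qed
  also have "(\<Sum>e\<in>{e\<in>Ess. i \<notin> set_uprod e}. ?r e) =
      (\<Sum>e\<in>{e\<in>Ess. i \<notin> set_uprod e}. (ss_product U V e - (dss e)\<^sup>2)\<^sup>2)"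
  proof (rule sum.cong[OF refl])
    fix e assume "e \<in> {e\<in>Ess. i \<notin> set_uprod e}"
    then show "?r e = (ss_product U V e - (dss e)\<^sup>2)\<^sup>2"
      by (cases e) (auto simp: column_upd_column)
  qed
  finally show ?thesis .
qed

lemma sa_sum_upd_column:
  fixes Esa :: "('m::finite \<times> 'n::finite) set"
  shows "(\<Sum>(l, k)\<in>Esa. ((a k - column l (upd_column i x U)) \<bullet> (a k - column l V) - (dsa (l, k))\<^sup>2)\<^sup>2) =
    (\<Sum>k\<in>sa_nbrs Esa i. (x \<bullet> (column i V - a k) -
        (a k \<bullet> column i V - a k \<bullet> a k + (dsa (i, k))\<^sup>2))\<^sup>2) +
    (\<Sum>(l, k)\<in>{e\<in>Esa. fst e \<noteq> i}. ((a k - column l U) \<bullet> (a k - column l V) - (dsa (l, k))\<^sup>2)\<^sup>2)"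
proof -
  let ?r = "\<lambda>(l, k). ((a k - column l (upd_column i x U)) \<bullet> (a k - column l V) - (dsa (l, k))\<^sup>2)\<^sup>2"
  have edges_at: "{e\<in>Esa. fst e = i} = Pair i ` sa_nbrs Esa i"
    by (auto simp: sa_nbrs_def)
  have inj: "inj_on (Pair i) (sa_nbrs Esa i)"
    by (auto simp: inj_on_def)
  have "(\<Sum>e\<in>Esa. ?r e) = (\<Sum>e\<in>{e\<in>Esa. fst e = i}. ?r e) + (\<Sum>e\<in>{e\<in>Esa. fst e \<noteq> i}. ?r e)"
    by (subst sum.union_disjoint[symmetric]) (auto intro!: sum.cong)
  also have "(\<Sum>e\<in>{e\<in>Esa. fst e = i}. ?r e) = (\<Sum>k\<in>sa_nbrs Esa i. ?r (i, k))"
    by (simp add: edges_at sum.reindex[OF inj])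
  also have "\<dots> = (\<Sum>k\<in>sa_nbrs Esa i. (x \<bullet> (column i V - a k) -
        (a k \<bullet> column i V - a k \<bullet> a k + (dsa (i, k))\<^sup>2))\<^sup>2)"
    by (simp add: column_upd_column inner_diff_left inner_diff_right algebra_simps)
  also have "(\<Sum>e\<in>{e\<in>Esa. fst e \<noteq> i}. ?r e) =
      (\<Sum>(l, k)\<in>{e\<in>Esa. fst e \<noteq> i}. ((a k - column l U) \<bullet> (a k - column l V) - (dsa (l, k))\<^sup>2)\<^sup>2)"
    by (rule sum.cong) (auto simp: column_upd_column)
  finally show ?thesis .
qed

lemma sum_squared_residuals:
  fixes w :: "'b \<Rightarrow> 'c::real_inner"
  shows "(\<Sum>j\<in>S. (x \<bullet> w j - c j)\<^sup>2) =
    (\<Sum>j\<in>S. (x \<bullet> w j) * (x \<bullet> w j)) - 2 * ((\<Sum>j\<in>S. c j *\<^sub>R w j) \<bullet> x) + (\<Sum>j\<in>S. (c j)\<^sup>2)"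
  by (simp add: power2_diff sum.distrib sum_subtractf inner_sum_left sum_distrib_left
      inner_commute[of x] power2_eq_square[of "w _ \<bullet> x"] mult_ac)

text \<open>
  The regularisation term contributes \<open>\<gamma> I\<close> to the matrix and \<open>\<gamma> v\<^sub>i\<close> to the vector; a residual
  \<open>x \<bullet> w - c\<close> contributes \<open>w w\<^sup>T\<close> and \<open>c w\<close>.
\<close>

lemma F_snl_upd_column_quadratic:
  fixes Ess :: "'m::finite uprod set" and Esa :: "('m \<times> 'n::finite) set"
  assumes proper: "\<forall>e\<in>Ess. proper_uprod e"
  obtains C where "\<And>x. F_snl Ess Esa a dss dsa \<gamma> (upd_column i x U) V =
    1/2 * (x \<bullet> (A_snl Ess Esa a \<gamma> V i *v x)) - b_snl Ess Esa a dss dsa \<gamma> U V i \<bullet> x + C"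
proof -
  define Cn where "Cn = (\<Sum>c\<in>UNIV - {i}. (norm (column c U - column c V))\<^sup>2)"
  define Cs where "Cs = (\<Sum>e\<in>{e\<in>Ess. i \<notin> set_uprod e}. (ss_product U V e - (dss e)\<^sup>2)\<^sup>2)"
  define Ca where "Ca = (\<Sum>(l, k)\<in>{e\<in>Esa. fst e \<noteq> i}.
    ((a k - column l U) \<bullet> (a k - column l V) - (dsa (l, k))\<^sup>2)\<^sup>2)"
  define cs where
    "cs j = column j U \<bullet> column i V - column j U \<bullet> column j V + (dss (Upair i j))\<^sup>2" for j
  define ca where "ca k = a k \<bullet> column i V - a k \<bullet> a k + (dsa (i, k))\<^sup>2" for k
  have norm_sq: "(norm (x - column i V))\<^sup>2 =
      x \<bullet> x - 2 * (column i V \<bullet> x) + column i V \<bullet> column i V" for x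
    by (simp add: power2_norm_eq_inner inner_diff_left inner_diff_right inner_commute)
  show thesis
  proof (rule that)
    fix x
    show "F_snl Ess Esa a dss dsa \<gamma> (upd_column i x U) V =
      1/2 * (x \<bullet> (A_snl Ess Esa a \<gamma> V i *v x)) - b_snl Ess Esa a dss dsa \<gamma> U V i \<bullet> x +
      (\<gamma> / 2 * (column i V \<bullet> column i V + Cn) +
       1/2 * ((\<Sum>j\<in>ss_nbrs Ess i. (cs j)\<^sup>2) + Cs) + 1/2 * ((\<Sum>k\<in>sa_nbrs Esa i. (ca k)\<^sup>2) + Ca))"
      unfolding F_snl_def f_snl_def Frobenius_upd_column ss_sum_upd_column[OF proper]
        sa_sum_upd_column inner_A_snl_mult b_snl_def norm_sq
        Cn_def[symmetric] Cs_def[symmetric] Ca_def[symmetric]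
        cs_def[symmetric] ca_def[symmetric] sum_squared_residuals inner_add_left
      by (simp add: field_simps)
  qed
qed

section \<open>Closed form of the block updates\<close>

lemma is_arg_min_F_snl_upd_column_iff:
  fixes Ess :: "'m::finite uprod set" and Esa :: "('m \<times> 'n::finite) set"
  assumes proper: "\<forall>e\<in>Ess. proper_uprod e" and "0 < \<gamma>"
  shows "is_arg_min (\<lambda>x. F_snl Ess Esa a dss dsa \<gamma> (upd_column i x U) V) (\<lambda>_. True) u \<longleftrightarrow>
    u = matrix_inv (A_snl Ess Esa a \<gamma> V i) *v b_snl Ess Esa a dss dsa \<gamma> U V i"
proof -
  obtain C where "\<And>x. F_snl Ess Esa a dss dsa \<gamma> (upd_column i x U) V =
    1/2 * (x \<bullet> (A_snl Ess Esa a \<gamma> V i *v x)) - b_snl Ess Esa a dss dsa \<gamma> U V i \<bullet> x + C"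
    using F_snl_upd_column_quadratic[OF proper] by blast
  from is_arg_min_quadratic_iff[where q = "\<lambda>x. F_snl Ess Esa a dss dsa \<gamma> (upd_column i x U) V",
      OF A_snl_sym A_snl_pos_def[OF \<open>0 < \<gamma>\<close>] this]
  show ?thesis .
qed

theorem theorem2:
  fixes Ess :: "'m::finite uprod set"
    and Esa :: "('m \<times> 'n::finite) set"
    and a :: "'n \<Rightarrow> real ^ 'd::finite"
    and dss :: "'m uprod \<Rightarrow> real"
    and dsa :: "'m \<times> 'n \<Rightarrow> real"
    and \<gamma> :: real
    and U' V' :: "real ^ 'm ^ 'd"
    and i :: 'm
  assumes "\<forall>e\<in>Ess. proper_uprod e"
    and "\<forall>e\<in>Ess. 0 \<le> dss e"
    and "\<forall>e\<in>Esa. 0 \<le> dsa e"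
    and "0 < \<gamma>"
  shows "invertible (A_snl Ess Esa a \<gamma> V' i) \<and>
    invertible (A_snl Ess Esa a \<gamma> U' i) \<and>
    (\<forall>u. is_arg_min (\<lambda>x. F_snl Ess Esa a dss dsa \<gamma> (upd_column i x U') V') (\<lambda>_. True) u \<longleftrightarrow>
         u = matrix_inv (A_snl Ess Esa a \<gamma> V' i) *v b_snl Ess Esa a dss dsa \<gamma> U' V' i) \<and>
    (\<forall>v. is_arg_min (\<lambda>x. F_snl Ess Esa a dss dsa \<gamma> U' (upd_column i x V')) (\<lambda>_. True) v \<longleftrightarrow>
         v = matrix_inv (A_snl Ess Esa a \<gamma> U' i) *v b_snl Ess Esa a dss dsa \<gamma> V' U' i)"
proof -
  have inv: "invertible (A_snl Ess Esa a \<gamma> Y i)" for Y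
    using A_snl_pos_def[OF assms(4)] by (rule invertible_pos_def)
  show ?thesis
    by (simp add: inv is_arg_min_F_snl_upd_column_iff[OF assms(1,4)]
        F_snl_commute[of Ess Esa a dss dsa \<gamma> U'])
qed

end
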